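(* For any graphs $G$ and $H$, $$\Gamma(G\square H)\ge\Gamma(G)\Gamma(H)+\min\{|V(G)|-\Gamma(G),\,|V(H)|-\Gamma(H)\}.$$
   Context: All graphs are finite, simple and have at least one vertex. A subset $D$ of $V(G)$ is a dominating set of $G$ if every vertex in $V(G)\setminus D$ has at least one neighbor in $D$. A dominating set $D$ of $G$ is a minimal dominating set if no proper subset of $D$ is a dominating set of $G$. The upper domination number $\Gamma(G)$ is the maximum cardinality of a minimal dominating set of $G$. The Cartesian product $G\square H$ is the graph with vertex set $V(G)\times V(H)$ in which $(u_1,v_1)$ and $(u_2,v_2)$ are adjacent if and only if either $u_1=u_2$ and $v_1v_2\in E(H)$, or $v_1=v_2$ and $u_1u_2\in E(G)$. *)

theory Defs
  imports "Graph_Theory.Pair_Digraph"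
begin

text \<open>
  Finite simple graphs are the symmetric, loop-free, finite digraphs without parallel arcs of
  \<^locale>\<open>pair_graph\<close>: an undirected edge between u and v is the pair of arcs
  (u,v) and (v,u). That locale admits the graph without vertices, so non-emptiness of
  \<^const>\<open>pverts\<close> is a separate assumption.
\<close>

definition dominating_set :: "'a pair_pre_digraph \<Rightarrow> 'a set \<Rightarrow> bool" where
  "dominating_set G D \<longleftrightarrow>
     D \<subseteq> pverts G \<and> (\<forall>v \<in> pverts G - D. \<exists>u \<in> D. (v, u) \<in> parcs G)"

definition minimal_dominating_set :: "'a pair_pre_digraph \<Rightarrow> 'a set \<Rightarrow> bool" where
  "minimal_dominating_set G D \<longleftrightarrow>
     dominating_set G D \<and> (\<forall>D'. D' \<subset> D \<longrightarrow> \<not> dominating_set G D')"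

definition upper_domination_number :: "'a pair_pre_digraph \<Rightarrow> nat" where
  "upper_domination_number G = Max (card ` {D. minimal_dominating_set G D})"

definition cartesian_product ::
    "'a pair_pre_digraph \<Rightarrow> 'b pair_pre_digraph \<Rightarrow> ('a \<times> 'b) pair_pre_digraph" where
  "cartesian_product G H =
     \<lparr> pverts = pverts G \<times> pverts H,
       parcs = {((u1, v1), (u2, v2)) | u1 v1 u2 v2.
         (u1, v1) \<in> pverts G \<times> pverts H \<and> (u2, v2) \<in> pverts G \<times> pverts H \<and>
         (u1 = u2 \<and> (v1, v2) \<in> parcs H \<or> v1 = v2 \<and> (u1, u2) \<in> parcs G)} \<rparr>"

lemma pair_graph_cartesian_product:
  fixes G :: "'a pair_pre_digraph" and H :: "'b pair_pre_digraph"
  assumes "pair_graph G" "pair_graph H"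
  shows "pair_graph (cartesian_product G H)"
proof -
  interpret G: pair_graph G by fact
  interpret H: pair_graph H by fact
  let ?P = "cartesian_product G H"
  have "parcs ?P \<subseteq> (pverts G \<times> pverts H) \<times> (pverts G \<times> pverts H)"
    by (auto simp: cartesian_product_def)
  then have "finite (parcs ?P)"
    by (rule finite_subset) simp
  moreover have "sym (parcs ?P)"
    by (auto simp: cartesian_product_def sym_def intro: G.arcs_symmetric H.arcs_symmetric)
  ultimately show ?thesis
    by unfold_locales
      (auto simp: cartesian_product_def symmetric_def dest: G.no_loops' H.no_loops')
qed

text \<open>
  For a finite graph the maximum defining \<^const>\<open>upper_domination_number\<close> is attained, so it
  is not an unspecified value of \<^const>\<open>Max\<close>; it is at most the number of vertices, so
  subtracting it from that number is not truncated.
\<close>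

lemma upper_domination_number_attained:
  fixes G :: "'a pair_pre_digraph"
  assumes "finite (pverts G)"
  shows "\<exists>D. minimal_dominating_set G D \<and> card D = upper_domination_number G"
    and "minimal_dominating_set G D \<Longrightarrow> card D \<le> upper_domination_number G"
proof -
  let ?S = "{D. dominating_set G D}"
  have "?S \<subseteq> Pow (pverts G)"
    by (auto simp: dominating_set_def)
  then have fin: "finite ?S"
    using assms by (simp add: finite_subset)
  have "pverts G \<in> ?S"
    by (auto simp: dominating_set_def)
  then obtain M where "M \<in> ?S" "\<forall>D \<in> ?S. D \<subseteq> M \<longrightarrow> D = M"
    using finite_has_minimal[OF fin] by blast
  then have "minimal_dominating_set G M"
    by (auto simp: minimal_dominating_set_def)
  then have ne: "card ` {D. minimal_dominating_set G D} \<noteq> {}"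
    by blast
  have "{D. minimal_dominating_set G D} \<subseteq> ?S"
    by (auto simp: minimal_dominating_set_def)
  then have fin': "finite (card ` {D. minimal_dominating_set G D})"
    using fin by (blast intro: finite_subset finite_imageI)
  show "\<exists>D. minimal_dominating_set G D \<and> card D = upper_domination_number G"
    using Max_in[OF fin' ne] unfolding upper_domination_number_def by force
  show "card D \<le> upper_domination_number G" if "minimal_dominating_set G D"
    using Max_ge[OF fin'] that unfolding upper_domination_number_def by blast
qed

lemma upper_domination_number_le_card:
  fixes G :: "'a pair_pre_digraph"
  assumes "finite (pverts G)"
  shows "upper_domination_number G \<le> card (pverts G)"
proof -
  obtain D where D: "minimal_dominating_set G D" "card D = upper_domination_number G"
    using upper_domination_number_attained(1)[OF assms] by blast
  then have "D \<subseteq> pverts G"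
    by (simp add: minimal_dominating_set_def dominating_set_def)
  then show ?thesis
    using card_mono[OF assms] D(2) by metis
qed

end

theory Submission
  imports Defs
begin

text \<open>
  Take minimal dominating sets A of G and B of H of maximum size, and let Y be the complement of B.

  If A and B are independent, A \<times> B together with all pairs outside both sets dominates, and any
  minimal dominating subset keeps A \<times> B. The pairs outside both sets are not dominated by
  A \<times> B, so the remaining vertices of the subset meet all rows or all columns outside A and B.

  If A has an edge, let J be the set of its non-isolated vertices and p j an external private
  neighbour of j; let f b be a private neighbour of b with respect to B, so that conversely b is
  private to f b with respect to f(B). Replace A \<times> B by the equally large set which has f(B)
  instead of B over each vertex of A that is isolated in A but not in G. Then (p j, b) stays private
  to (j, b), and together with the pairs (x, h), h \<in> Y, where x is neither of the form p j nor
  isolated in A, one gets a dominating set. A minimal dominating subset keeps the replaced set, and to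
  dominate (p j, h) it needs a further vertex in each row h \<in> Y.
\<close>

section \<open>Closed neighbourhoods and private neighbours\<close>

text \<open>Adjacency or equality, so that a vertex may be its own private neighbour and domination
  becomes one condition on all vertices.\<close>

definition cnb :: "'a pair_pre_digraph \<Rightarrow> 'a \<Rightarrow> 'a \<Rightarrow> bool" where
  "cnb G u v \<longleftrightarrow> u = v \<or> (u, v) \<in> parcs G"

lemma cnb_refl: "cnb G v v"
  by (simp add: cnb_def)

lemma cnb_sym:
  assumes "pair_graph G" "cnb G u v"
  shows "cnb G v u"
proof -
  interpret pair_graph G by fact
  show ?thesis using assms(2) by (auto simp: cnb_def intro: arcs_symmetric)
qed

lemma dominating_set_iff:
  "dominating_set G D \<longleftrightarrow> D \<subseteq> pverts G \<and> (\<forall>v \<in> pverts G. \<exists>u \<in> D. cnb G v u)"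
  unfolding dominating_set_def cnb_def by blast

lemma cnb_cartesian_product:
  assumes "u \<in> pverts G" "x \<in> pverts G" "v \<in> pverts H" "y \<in> pverts H"
  shows "cnb (cartesian_product G H) (u, v) (x, y) \<longleftrightarrow> u = x \<and> cnb H v y \<or> v = y \<and> cnb G u x"
  using assms by (auto simp: cnb_def cartesian_product_def)

lemma pverts_cartesian_product: "pverts (cartesian_product G H) = pverts G \<times> pverts H"
  by (simp add: cartesian_product_def)

text \<open>Removing \<open>x\<close> leaves some \<open>f\<close> undominated; as \<open>D\<close>
  dominates \<open>f\<close>, only \<open>x\<close> did so. Possibly \<open>f = x\<close>.\<close>

lemma minimal_dominating_set_private:
  assumes "minimal_dominating_set G D" "x \<in> D"
  obtains f where "f \<in> pverts G" "cnb G f x" "\<And>y. y \<in> D \<Longrightarrow> cnb G f y \<Longrightarrow> y = x"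
proof -
  have "\<not> dominating_set G (D - {x})" and "dominating_set G D"
    using assms by (auto simp: minimal_dominating_set_def)
  then obtain f where f: "f \<in> pverts G" "\<And>y. y \<in> D - {x} \<Longrightarrow> \<not> cnb G f y"
    unfolding dominating_set_iff by blast
  with \<open>dominating_set G D\<close> have "cnb G f x"
    unfolding dominating_set_iff by blast
  with f that show thesis by blast
qed

lemma minimal_dominating_subset:
  assumes "finite (pverts G)" "dominating_set G C"
  obtains D where "D \<subseteq> C" "minimal_dominating_set G D"
proof -
  let ?S = "{D. D \<subseteq> C \<and> dominating_set G D}"
  have "?S \<subseteq> Pow (pverts G)"
    by (auto simp: dominating_set_def)
  then have fin: "finite ?S"
    using assms(1) by (simp add: finite_subset)
  have ne: "?S \<noteq> {}"
    using assms(2) by auto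
  from finite_has_minimal[OF fin ne]
  obtain D where D: "D \<in> ?S" "\<forall>E \<in> ?S. E \<subseteq> D \<longrightarrow> D = E"
    by (rule bexE)
  then have "minimal_dominating_set G D"
    unfolding minimal_dominating_set_def by blast
  with D(1) that show thesis by blast
qed

text \<open>Shows which vertices of a large set \<open>C\<close> survive in all its dominating
  subsets: those with a private neighbour with respect to \<open>C\<close>.\<close>

lemma dominating_set_private_mem:
  assumes "dominating_set G D" "D \<subseteq> C" "f \<in> pverts G"
    and "\<And>y. y \<in> C \<Longrightarrow> cnb G f y \<Longrightarrow> y = x"
  shows "x \<in> D"
  using assms unfolding dominating_set_iff by blast

section \<open>Exchanging the factors\<close>

lemma dominating_set_cartesian_product_swap:
  assumes "dominating_set (cartesian_product G H) D"
  shows "dominating_set (cartesian_product H G) (prod.swap ` D)"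
  unfolding dominating_set_iff
proof (intro conjI ballI)
  show "prod.swap ` D \<subseteq> pverts (cartesian_product H G)"
    using assms by (auto simp: dominating_set_iff pverts_cartesian_product)
next
  fix z assume "z \<in> pverts (cartesian_product H G)"
  then have "prod.swap z \<in> pverts (cartesian_product G H)"
    by (auto simp: pverts_cartesian_product)
  then obtain d where d: "d \<in> D" "cnb (cartesian_product G H) (prod.swap z) d"
    using assms unfolding dominating_set_iff by blast
  from d(2) have "cnb (cartesian_product H G) z (prod.swap d)"
    by (cases z; cases d) (auto simp: cnb_def cartesian_product_def)
  with d(1) show "\<exists>u \<in> prod.swap ` D. cnb (cartesian_product H G) z u"
    by blast
qed

lemma minimal_dominating_set_cartesian_product_swap:
  assumes "minimal_dominating_set (cartesian_product G H) D"
  shows "minimal_dominating_set (cartesian_product H G) (prod.swap ` D)"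
  unfolding minimal_dominating_set_def
proof (intro conjI allI impI notI)
  show "dominating_set (cartesian_product H G) (prod.swap ` D)"
    using assms by (simp add: minimal_dominating_set_def dominating_set_cartesian_product_swap)
next
  fix E assume E: "E \<subset> prod.swap ` D" "dominating_set (cartesian_product H G) E"
  have "prod.swap ` E \<subset> D"
    using image_strict_mono[OF _ E(1), of prod.swap] by (simp add: image_image)
  then show False
    using assms dominating_set_cartesian_product_swap[OF E(2)]
    by (simp add: minimal_dominating_set_def)
qed

text \<open>\<open>prod.swap\<close> preserves minimal dominating sets and their sizes. This later
  reduces an edge inside \<open>B\<close> to an edge inside \<open>A\<close>.\<close>

lemma upper_domination_number_cartesian_product_swap_le:
  assumes "pair_graph G" "pair_graph H"
  shows "upper_domination_number (cartesian_product H G)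
    \<le> upper_domination_number (cartesian_product G H)"
proof -
  interpret G: pair_graph G by fact
  interpret H: pair_graph H by fact
  have fin: "finite (pverts (cartesian_product G H))" "finite (pverts (cartesian_product H G))"
    by (simp_all add: pverts_cartesian_product)
  obtain D where D: "minimal_dominating_set (cartesian_product H G) D"
      "card D = upper_domination_number (cartesian_product H G)"
    using upper_domination_number_attained(1)[OF fin(2)] by blast
  have "card (prod.swap ` D) = card D"
    by (intro card_image) simp
  then show ?thesis
    using upper_domination_number_attained(2)[OF fin(1)
        minimal_dominating_set_cartesian_product_swap[OF D(1)]] D(2) by simp
qed

section \<open>Both dominating sets independent\<close>

lemma upper_domination_number_independent:
  fixes G :: "'a pair_pre_digraph" and H :: "'b pair_pre_digraph"
  assumes "pair_graph G" "pair_graph H"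
    and A: "dominating_set G A" and B: "dominating_set H B"
    and indA: "\<And>u v. u \<in> A \<Longrightarrow> v \<in> A \<Longrightarrow> (u, v) \<notin> parcs G"
    and indB: "\<And>u v. u \<in> B \<Longrightarrow> v \<in> B \<Longrightarrow> (u, v) \<notin> parcs H"
  shows "card A * card B + min (card (pverts G) - card A) (card (pverts H) - card B)
    \<le> upper_domination_number (cartesian_product G H)"
proof -
  interpret G: pair_graph G by fact
  interpret H: pair_graph H by fact
  let ?P = "cartesian_product G H"
  define X Y where "X = pverts G - A" and "Y = pverts H - B"
  define C where "C = A \<times> B \<union> X \<times> Y"
  have AV: "A \<subseteq> pverts G" and BW: "B \<subseteq> pverts H"
    using A B by (auto simp: dominating_set_def)
  then have finA: "finite A" and finB: "finite B"
    by (auto intro: finite_subset)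
  have finP: "finite (pverts ?P)"
    by (simp add: pverts_cartesian_product)
  have CV: "C \<subseteq> pverts G \<times> pverts H"
    using AV BW by (auto simp: C_def X_def Y_def)
  have "\<exists>c \<in> C. cnb ?P (v, w) c" if vw: "v \<in> pverts G" "w \<in> pverts H" for v w
  proof -
    consider "v \<in> A" | "w \<in> B" | "v \<in> X" "w \<in> Y"
      using vw by (auto simp: X_def Y_def)
    then show ?thesis
    proof cases
      case 1
      obtain b where "b \<in> B" "cnb H w b"
        using B vw by (auto simp: dominating_set_iff)
      with 1 vw BW show ?thesis
        by (intro bexI[of _ "(v, b)"]) (auto simp: C_def cnb_cartesian_product)
    next
      case 2
      obtain a where "a \<in> A" "cnb G v a"
        using A vw by (auto simp: dominating_set_iff)
      with 2 vw AV show ?thesis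
        by (intro bexI[of _ "(a, w)"]) (auto simp: C_def cnb_cartesian_product)
    next
      case 3
      then show ?thesis
        by (intro bexI[of _ "(v, w)"]) (auto simp: C_def cnb_refl)
    qed
  qed
  then have "dominating_set ?P C"
    using CV by (auto simp: dominating_set_iff pverts_cartesian_product)
  then obtain D where D: "D \<subseteq> C" "minimal_dominating_set ?P D"
    using minimal_dominating_subset[OF finP] by blast
  then have domD: "dominating_set ?P D"
    by (simp add: minimal_dominating_set_def)
  have sub: "A \<times> B \<subseteq> D"
  proof clarify
    fix a b assume ab: "a \<in> A" "b \<in> B"
    show "(a, b) \<in> D"
    \<comment> \<open>\<open>(a, b)\<close> is its own private neighbour: a neighbour keeps one
      coordinate, so it is not in \<open>X \<times> Y\<close>, and one in
      \<open>A \<times> B\<close> would give an edge inside \<open>A\<close> or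
      \<open>B\<close>.\<close>
    proof (rule dominating_set_private_mem[OF domD D(1), of "(a, b)"])
      show "(a, b) \<in> pverts ?P"
        using ab AV BW by (auto simp: pverts_cartesian_product)
    next
      fix c assume c: "c \<in> C" "cnb ?P (a, b) c"
      obtain x y where [simp]: "c = (x, y)" by (cases c)
      show "c = (a, b)"
        using c CV ab AV BW indA indB
        by (auto simp: C_def X_def Y_def cnb_def cartesian_product_def)
    qed
  qed
  define E where "E = D - A \<times> B"
  have finD: "finite D"
    using finite_subset[OF subset_trans[OF D(1) CV]] by simp
  have ES: "E \<subseteq> X \<times> Y"
    using D(1) by (auto simp: E_def C_def)
  have finE: "finite E"
    using finD by (simp add: E_def)
  have "X \<subseteq> fst ` E \<or> Y \<subseteq> snd ` E"
  proof (rule ccontr)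
    assume "\<not> ?thesis"
    then obtain g h where gh: "g \<in> X" "g \<notin> fst ` E" "h \<in> Y" "h \<notin> snd ` E"
      by blast
    then have "(g, h) \<in> pverts ?P"
      by (simp add: X_def Y_def pverts_cartesian_product)
    then obtain d where d: "d \<in> D" "cnb ?P (g, h) d"
      using domD unfolding dominating_set_iff by blast
    obtain x y where xy: "d = (x, y)" by (cases d)
    have "x \<in> pverts G" "y \<in> pverts H"
      using d(1) D(1) CV xy by auto
    then have "x = g \<or> y = h"
      using d(2) gh unfolding xy by (auto simp: cnb_cartesian_product X_def Y_def)
    moreover have "d \<in> E \<or> x \<in> A \<and> y \<in> B"
      using d(1) xy by (auto simp: E_def)
    ultimately show False
      using gh xy by (force simp: X_def Y_def)
  qed
  then have "min (card X) (card Y) \<le> card E"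
    using surj_card_le[OF finE, of X fst] surj_card_le[OF finE, of Y snd] by auto
  moreover have "card X = card (pverts G) - card A" "card Y = card (pverts H) - card B"
    using AV BW finA finB by (simp_all add: X_def Y_def card_Diff_subset)
  moreover have "card D = card A * card B + card E"
    using sub finD finA finB card_mono[OF finD sub]
    by (simp add: E_def card_Diff_subset card_cartesian_product)
  ultimately show ?thesis
    using upper_domination_number_attained(2)[OF finP D(2)] by simp
qed

section \<open>An edge inside one of the dominating sets\<close>

lemma upper_domination_number_not_independent:
  fixes G :: "'a pair_pre_digraph" and H :: "'b pair_pre_digraph"
  assumes "pair_graph G" "pair_graph H"
    and A: "minimal_dominating_set G A" and B: "minimal_dominating_set H B"
    and edge: "a0 \<in> A" "a1 \<in> A" "(a0, a1) \<in> parcs G"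
  shows "card A * card B + (card (pverts H) - card B)
    \<le> upper_domination_number (cartesian_product G H)"
proof -
  interpret G: pair_graph G by fact
  interpret H: pair_graph H by fact
  let ?P = "cartesian_product G H"
  define Y where "Y = pverts H - B"
  define J where "J = {a \<in> A. \<exists>a' \<in> A. (a, a') \<in> parcs G}"
  \<comment> \<open>The vertices of \<open>A - J - M\<close> are isolated in
    \<open>G\<close>.\<close>
  define M where "M = {a \<in> A - J. \<exists>g. (a, g) \<in> parcs G}"
  have domA: "dominating_set G A" and domB: "dominating_set H B"
    using A B by (auto simp: minimal_dominating_set_def)
  have AV: "A \<subseteq> pverts G" and BW: "B \<subseteq> pverts H"
    using domA domB by (auto simp: dominating_set_def)
  then have finA: "finite A" and finB: "finite B"
    by (auto intro: finite_subset)
  have finP: "finite (pverts ?P)"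
    by (simp add: pverts_cartesian_product)
  have "\<forall>a \<in> A. \<exists>q \<in> pverts G. cnb G q a \<and> (\<forall>y \<in> A. cnb G q y \<longrightarrow> y = a)"
    using minimal_dominating_set_private[OF A] by metis
  then obtain p where p: "\<And>a. a \<in> A \<Longrightarrow> p a \<in> pverts G" "\<And>a. a \<in> A \<Longrightarrow> cnb G (p a) a"
      "\<And>a y. a \<in> A \<Longrightarrow> y \<in> A \<Longrightarrow> cnb G (p a) y \<Longrightarrow> y = a"
    by metis
  have "\<forall>b \<in> B. \<exists>q \<in> pverts H. cnb H q b \<and> (\<forall>y \<in> B. cnb H q y \<longrightarrow> y = b)"
    using minimal_dominating_set_private[OF B] by metis
  then obtain f where f: "\<And>b. b \<in> B \<Longrightarrow> f b \<in> pverts H" "\<And>b. b \<in> B \<Longrightarrow> cnb H (f b) b"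
      "\<And>b y. b \<in> B \<Longrightarrow> y \<in> B \<Longrightarrow> cnb H (f b) y \<Longrightarrow> y = b"
    by metis
  have JA: "J \<subseteq> A" and MA: "M \<subseteq> A" and MJ: "M \<inter> J = {}"
    by (auto simp: J_def M_def)
  \<comment> \<open>Otherwise \<open>p j = j\<close> would also see a neighbour of \<open>j\<close>
    in \<open>A\<close>.\<close>
  have pJ: "p j \<notin> A" if "j \<in> J" for j
  proof
    assume "p j \<in> A"
    then have "p j = j"
      using p(3)[of j "p j"] that JA by (auto simp: cnb_refl)
    moreover obtain a where "a \<in> A" "(j, a) \<in> parcs G"
      using \<open>j \<in> J\<close> by (auto simp: J_def)
    ultimately show False
      using p(3)[of j a] that JA G.no_loops' by (auto simp: cnb_def)
  qed
  have fB: "f b = b" if "b \<in> B" "f b \<in> B" for b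
    using f(3)[OF that] by (simp add: cnb_refl)
  have I: "x = i" if "i \<in> A - J" "x \<in> A" "cnb G i x" for i x
    using that by (auto simp: cnb_def J_def)
  \<comment> \<open>\<open>(a, s a b)\<close> replaces \<open>(a, b)\<close>, and
    \<open>t a b\<close> will be its private neighbour. Over \<open>M\<close> the swap is needed
    because \<open>(a, f b)\<close> may be dominated by a neighbour of \<open>a\<close> in row
    \<open>f b\<close>, whereas row \<open>b\<close> avoids \<open>R \<times> Y\<close>.\<close>
  define s where "s a b = (if a \<in> M then f b else b)" for a b
  define t where "t a b = (if a \<in> J then (p a, b) else if a \<in> M then (a, b) else (a, f b))" for a b
  define D0 where "D0 = (\<lambda>(a, b). (a, s a b)) ` (A \<times> B)"
  \<comment> \<open>The columns left out are exactly those containing some \<open>t a b\<close>.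
    \<open>J\<close> stays in \<open>R\<close>, since \<open>p j\<close> is never in
    \<open>A\<close>.\<close>
  define R where "R = pverts G - (A - J) - p ` J"
  define C where "C = D0 \<union> R \<times> Y"
  have sW: "s a b \<in> pverts H" if "b \<in> B" for a b
    using that f(1) BW by (auto simp: s_def)
  have CV: "C \<subseteq> pverts G \<times> pverts H"
    using AV sW by (auto simp: C_def D0_def R_def Y_def)
  have RY: "(x, y) \<in> C" if "x \<in> R" "y \<in> Y" for x y
    using that by (simp add: C_def)
  have "\<exists>x y. (x, y) \<in> C \<and> (v = x \<and> cnb H w y \<or> w = y \<and> cnb G v x)"
    if vw: "v \<in> pverts G" "w \<in> pverts H" for v w
  proof (cases "w \<in> B")
    case False
    then have wY: "w \<in> Y" using vw by (simp add: Y_def)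
    consider "v \<in> R" | j where "j \<in> J" "v = p j" | "v \<in> M" | "v \<in> A - J - M"
      using vw by (auto simp: R_def)
    then show ?thesis
    proof cases
      case 1
      with wY show ?thesis using RY[of v w] cnb_refl[of H w] by blast
    next
      case 2
      have "j \<in> R" using 2 pJ JA AV by (auto simp: R_def)
      moreover have "cnb G v j" using 2 p(2)[of j] JA by blast
      ultimately show ?thesis using RY[of j w] wY by blast
    next
      case 3
      then obtain g where g: "(v, g) \<in> parcs G" by (auto simp: M_def)
      then have gv: "cnb G v g" "cnb G g v" "g \<noteq> v"
        using cnb_sym[OF assms(1)] G.no_loops' by (auto simp: cnb_def)
      \<comment> \<open>\<open>v\<close> is isolated in \<open>A\<close>, which excludes
        \<open>g\<close> from \<open>A\<close>; and \<open>g = p j\<close> would see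
        \<open>v\<close> besides \<open>j\<close>.\<close>
      have "g \<notin> A" using I[of v g] gv 3 by (auto simp: M_def)
      moreover have "g \<notin> p ` J"
        using p(3)[of _ v] gv 3 JA MA MJ by blast
      moreover have "g \<in> pverts G" using g by (rule G.in_arcsD2)
      ultimately have "g \<in> R" by (simp add: R_def)
      with wY gv show ?thesis using RY[of g w] by blast
    next
      case 4
      obtain b where b: "b \<in> B" "cnb H w b"
        using domB vw by (auto simp: dominating_set_iff)
      have "(v, b) \<in> D0"
        using 4 b by (force simp: D0_def s_def)
      then have "(v, b) \<in> C" by (simp add: C_def)
      with b show ?thesis by blast
    qed
  next
    case True
    have D0I: "(a, s a w) \<in> C" if "a \<in> A" for a
      using that True by (auto simp: C_def D0_def)
    show ?thesis
    proof (cases "v \<in> A")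
      case vA: True
      have "cnb H w (s v w)"
        using cnb_sym[OF assms(2) f(2)[OF True]] by (simp add: s_def cnb_refl)
      with D0I[OF vA] show ?thesis by blast
    next
      case vA: False
      obtain a where a: "a \<in> A" "cnb G v a"
        using domA vw by (auto simp: dominating_set_iff)
      \<comment> \<open>Only the swap over \<open>M\<close> can remove \<open>(a, w)\<close>. Then
        \<open>f w\<close> lies in \<open>Y\<close>, and \<open>v\<close>, seeing \<open>a\<close>
        in \<open>M\<close>, is no \<open>p j\<close>; so \<open>(v, f w)\<close> takes
        over.\<close>
      consider "s a w = w" | "a \<in> M" "f w \<noteq> w"
        by (cases "a \<in> M") (auto simp: s_def)
      then show ?thesis
      proof cases
        case 1
        with D0I[OF a(1)] a(2) show ?thesis by auto
      next
        case 2
        then have "f w \<in> Y" using fB f(1) True by (auto simp: Y_def)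
        moreover have "v \<notin> p ` J"
          using p(3)[of _ a] a 2 JA MJ by blast
        then have "v \<in> R" using vA vw by (simp add: R_def)
        moreover have "cnb H w (f w)"
          using cnb_sym[OF assms(2) f(2)[OF True]] .
        ultimately show ?thesis using RY[of v "f w"] by blast
      qed
    qed
  qed
  then have "\<exists>c \<in> C. cnb ?P (v, w) c" if "v \<in> pverts G" "w \<in> pverts H" for v w
    using that CV by (metis cnb_cartesian_product mem_Sigma_iff subsetD)
  then have "dominating_set ?P C"
    using CV by (auto simp: dominating_set_iff pverts_cartesian_product)
  then obtain D where D: "D \<subseteq> C" "minimal_dominating_set ?P D"
    using minimal_dominating_subset[OF finP] by blast
  then have domD: "dominating_set ?P D"
    by (simp add: minimal_dominating_set_def)
  have sub: "D0 \<subseteq> D"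
  proof -
    have "(a, s a b) \<in> D" if ab: "a \<in> A" "b \<in> B" for a b
    proof (rule dominating_set_private_mem[OF domD D(1), of "t a b"])
      show t: "t a b \<in> pverts ?P"
        using ab AV BW p(1) f(1) by (auto simp: t_def pverts_cartesian_product)
      fix c assume c: "c \<in> C" "cnb ?P (t a b) c"
      obtain x y where xy: "c = (x, y)" by (cases c)
      obtain u v where uv: "t a b = (u, v)" by (cases "t a b")
      have nb: "u = x \<and> cnb H v y \<or> v = y \<and> cnb G u x"
        using c CV t unfolding xy uv
        by (subst (asm) cnb_cartesian_product) (auto simp: pverts_cartesian_product)
      consider b' where "x \<in> A" "b' \<in> B" "y = s x b'" | "x \<in> R" "y \<in> Y"
        using c(1) xy by (auto simp: C_def D0_def)
      then have "x = a \<and> y = s a b"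
      proof cases
        case 1
        consider "a \<in> J" "u = p a" "v = b" | "a \<in> M" "a \<in> A - J" "u = a" "v = b"
          | "a \<in> A - J" "a \<notin> M" "u = a" "v = f b"
          using uv ab MJ by (auto simp: t_def split: if_splits)
        then show ?thesis
        proof cases
          assume a: "a \<in> J" "u = p a" "v = b"
          then have "u \<noteq> x" using pJ 1 by blast
          then show ?thesis using nb a p(3)[OF ab(1) 1(1)] MJ by (auto simp: s_def)
        next
          assume a: "a \<in> M" "a \<in> A - J" "u = a" "v = b"
          then have "x = a" using nb I[OF a(2) 1(1)] by auto
          then have "y = f b'" "cnb H b y" using nb a 1 by (auto simp: s_def cnb_refl)
          then have "b = b'" using f(3)[OF 1(2) ab(2)] cnb_sym[OF assms(2)] by blast
          then show ?thesis using \<open>x = a\<close> 1 by simp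
        next
          assume a: "a \<in> A - J" "a \<notin> M" "u = a" "v = f b"
          then have "x = a" using nb I[OF a(1) 1(1)] by auto
          then have "y = b'" "cnb H (f b) y" using nb a 1 by (auto simp: s_def cnb_refl)
          then have "b' = b" using f(3)[OF ab(2) 1(2)] by blast
          then show ?thesis using \<open>x = a\<close> 1 by simp
        qed
      next
        case 2
        \<comment> \<open>Column \<open>u\<close> is outside \<open>R\<close>, so \<open>c\<close>
          would have to share row \<open>v\<close>. For \<open>a\<close> in \<open>J\<close> or
          \<open>M\<close> this row is \<open>b\<close>, outside \<open>Y\<close>; otherwise
          \<open>a\<close> is isolated in \<open>G\<close>.\<close>
        then show ?thesis
          using nb uv ab MJ
          by (auto simp: t_def R_def Y_def M_def cnb_def split: if_splits)
      qed
      then show "c = (a, s a b)" using xy by simp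
    qed
    then show ?thesis by (auto simp: D0_def)
  qed
  define E where "E = D - D0"
  have finD: "finite D"
    using finite_subset[OF subset_trans[OF D(1) CV]] by simp
  then have finE: "finite E"
    by (simp add: E_def)
  have a0: "a0 \<in> J"
    using edge by (auto simp: J_def)
  \<comment> \<open>\<open>C\<close> has no vertex in column \<open>p a0\<close>, so
    \<open>(p a0, h)\<close> is dominated within row \<open>h\<close>. A dominator in
    \<open>D0\<close> would lie over \<open>a0\<close>, where \<open>s\<close> changes nothing, and
    its row would be in \<open>B\<close>.\<close>
  have "Y \<subseteq> snd ` E"
  proof
    fix h assume h: "h \<in> Y"
    then have ph: "(p a0, h) \<in> pverts ?P"
      using p(1) edge by (simp add: Y_def pverts_cartesian_product)
    then obtain x y where d: "(x, y) \<in> D" "cnb ?P (p a0, h) (x, y)"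
      using domD unfolding dominating_set_iff by (metis surj_pair)
    have "x \<noteq> p a0"
      using d(1) D(1) a0 pJ by (auto simp: C_def D0_def R_def)
    then have y: "y = h" "cnb G (p a0) x"
      using d CV D(1) ph
      by (auto simp: cnb_def cartesian_product_def)
    have "(x, y) \<notin> D0"
    proof
      assume "(x, y) \<in> D0"
      then obtain b where "x \<in> A" "b \<in> B" "y = s x b"
        by (auto simp: D0_def)
      moreover from this have "x = a0"
        using p(3)[OF edge(1)] y by blast
      moreover have "a0 \<notin> M"
        using a0 MJ by blast
      ultimately show False
        using h y(1) by (simp add: s_def Y_def)
    qed
    with d y show "h \<in> snd ` E"
      by (force simp: E_def)
  qed
  then have "card Y \<le> card E"
    using surj_card_le[OF finE] by blast
  moreover have "card Y = card (pverts H) - card B"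
    using BW finB by (simp add: Y_def card_Diff_subset)
  \<comment> \<open>The replacement loses no vertices: \<open>f\<close> is injective, as
    \<open>f b\<close> sees only \<open>b\<close> in \<open>B\<close>.\<close>
  moreover have "inj_on (\<lambda>(a, b). (a, s a b)) (A \<times> B)"
  proof (rule inj_onI, clarsimp)
    fix a b b' assume "b \<in> B" "b' \<in> B" "s a b = s a b'"
    then show "b = b'"
      using f(2)[of b] f(3)[of b' b] by (auto simp: s_def split: if_splits)
  qed
  then have "card D0 = card A * card B"
    by (simp add: D0_def card_image card_cartesian_product)
  moreover have "card D = card D0 + card E"
    using sub finD by (simp add: E_def card_Diff_subset finite_subset card_mono)
  ultimately show ?thesis
    using upper_domination_number_attained(2)[OF finP D(2)] by simp
qed

theorem theorem10:
  fixes G :: "'a pair_pre_digraph" and H :: "'b pair_pre_digraph"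
  assumes "pair_graph G" and "pverts G \<noteq> {}"
    and "pair_graph H" and "pverts H \<noteq> {}"
  shows "upper_domination_number (cartesian_product G H)
    \<ge> upper_domination_number G * upper_domination_number H
      + min (card (pverts G) - upper_domination_number G)
            (card (pverts H) - upper_domination_number H)"
proof -
  interpret G: pair_graph G by fact
  interpret H: pair_graph H by fact
  obtain A where A: "minimal_dominating_set G A" "card A = upper_domination_number G"
    using upper_domination_number_attained(1)[OF G.finite_verts] by auto
  obtain B where B: "minimal_dominating_set H B" "card B = upper_domination_number H"
    using upper_domination_number_attained(1)[OF H.finite_verts] by auto
  consider u v where "u \<in> A" "v \<in> A" "(u, v) \<in> parcs G"
    | u v where "u \<in> B" "v \<in> B" "(u, v) \<in> parcs H"
    | "\<And>u v. u \<in> A \<Longrightarrow> v \<in> A \<Longrightarrow> (u, v) \<notin> parcs G"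
      "\<And>u v. u \<in> B \<Longrightarrow> v \<in> B \<Longrightarrow> (u, v) \<notin> parcs H"
    by blast
  then show ?thesis
  proof cases
    case 1
    from upper_domination_number_not_independent[OF assms(1,3) A(1) B(1) this]
    show ?thesis unfolding A(2) B(2) by linarith
  next
    \<comment> \<open>With the factors exchanged the gain is the first term of the minimum.\<close>
    case 2
    from upper_domination_number_not_independent[OF assms(3,1) B(1) A(1) this]
      upper_domination_number_cartesian_product_swap_le[OF assms(1,3)]
    show ?thesis unfolding A(2) B(2) by (simp add: mult.commute)
  next
    case 3
    have "dominating_set G A" "dominating_set H B"
      using A B by (simp_all add: minimal_dominating_set_def)
    from upper_domination_number_independent[OF assms(1,3) this 3]
    show ?thesis unfolding A(2) B(2) by simp
  qed
qed

end
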